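(* Let $\widehat{\mathbf U}=(\widehat{\mathcal E},\widehat{\mathcal F}_i)$ and $\mathbf M^{[k]}=(\mathcal J^{[k]},\mathcal H^{[k]}_i)$ be realizable. If $0<\lambda\le(1+v)^{-1}$, then $\mathbf M^{[k+1]}=(\mathcal J^{[k+1]},\mathcal H_i^{[k+1]})$ determined by the modified Richardson iteration $$\mathcal J^{[k+1]}=\mathcal J^{[k]}-\frac{\lambda}{W}\big(W\mathcal J^{[k]}+v^i\mathcal H^{[k]}_i-\widehat{\mathcal E}\big),\qquad \mathcal H^{[k+1]}_j=\mathcal H^{[k]}_j-\frac{\lambda}{W}\big(W\mathcal H^{[k]}_j+v^i\mathcal K^{[k]}_{ij}-\widehat{\mathcal F}_j\big)$$ is realizable.
   Context: $v^i\in\mathbb R^3$ is a three-velocity with $v=\sqrt{v_iv^i}<1$, $W=(1-v^2)^{-1/2}$, $u^\mu=W(1,v^i)$, metric $\eta=\mathrm{diag}(-1,1,1,1)$, Latin indices $1..3$. All covectors here ($\mathcal H_\mu$, $\widehat{\mathcal F}_\mu$) are orthogonal to $u^\mu$, so their time components are $\mathcal H_0=-v^i\mathcal H_i$, $\widehat{\mathcal F}_0=-v^i\widehat{\mathcal F}_i$. A pair $(a,b_i)$ of this type is realizable if $a>0$ and $a\ge\sqrt{b_\mu b^\mu}=\sqrt{b_ib^i-(v^ib_i)^2}$. For $\omega=(\vartheta,\varphi)\in\mathbb S^2$ put $\ell^{\hat\imath}=(\cos\vartheta,\sin\vartheta\cos\varphi,\sin\vartheta\sin\varphi)$ and $\ell^0=Wv_j\ell^{\hat\jmath}$,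 $\ell^i=\ell^{\hat\imath}+(W-1)v^i(v_j\ell^{\hat\jmath})/v^2$ ($\ell^i=\ell^{\hat\imath}$ if $v=0$); then $u_\mu\ell^\mu=0$ and $\ell_\mu\ell^\mu=1$. Exact closure assumption (standing): there is an $f^{[k]}\ge0$ on $\mathbb S^2$, integrable with positive integral, such that, with $\varepsilon>0$ the particle energy, $\mathcal J^{[k]}=\frac{\varepsilon}{4\pi}\int f^{[k]}d\omega$, $\mathcal H_\mu^{[k]}=\frac{\varepsilon}{4\pi}\int f^{[k]}\ell_\mu d\omega$, $\mathcal K_{\mu\nu}^{[k]}=\frac{\varepsilon}{4\pi}\int f^{[k]}\ell_\mu\ell_\nu d\omega$. *)

theory Defs
  imports "HOL-Analysis.Analysis"
begin

text \<open>
  Four-vectors and four-covectors are pairs (time component, spatial components)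
  of type \<^typ>\<open>real \<times> (real ^ 3)\<close>. The metric is diag(-1, 1, 1, 1), so spatial
  components do not change when an index is raised or lowered.
\<close>

definition mink :: "real \<times> (real ^ 3) \<Rightarrow> real \<times> (real ^ 3) \<Rightarrow> real" where
  "mink x y = - (fst x * fst y) + snd x \<bullet> snd y"

definition lower :: "real \<times> (real ^ 3) \<Rightarrow> real \<times> (real ^ 3)" where
  "lower x = (- fst x, snd x)"

definition lorentz :: "real ^ 3 \<Rightarrow> real" where
  "lorentz v = 1 / sqrt (1 - (norm v)\<^sup>2)"

definition four_velocity :: "real ^ 3 \<Rightarrow> real \<times> (real ^ 3)" where
  "four_velocity v = (lorentz v, lorentz v *\<^sub>R v)"

text \<open>
  A covector orthogonal to the four-velocity is determined by its spatial components
  b; \<open>orth_covector v b\<close> restores the time component.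
\<close>

definition orth_covector :: "real ^ 3 \<Rightarrow> real ^ 3 \<Rightarrow> real \<times> (real ^ 3)" where
  "orth_covector v b = (- (v \<bullet> b), b)"

definition realizable :: "real ^ 3 \<Rightarrow> real \<Rightarrow> real ^ 3 \<Rightarrow> bool" where
  "realizable v a b \<longleftrightarrow>
     a > 0 \<and> a \<ge> sqrt (mink (orth_covector v b) (orth_covector v b))"

text \<open>
  The unit sphere is parametrized by the angles \<open>\<omega> = (\<theta>, \<phi>)\<close>, with polar axis along
  the first coordinate; \<open>solid_angle\<close> is the surface measure
  \<open>d\<omega> = sin \<theta> d\<theta> d\<phi>\<close> in these coordinates.
\<close>

definition angles :: "(real \<times> real) set" where
  "angles = {0..pi} \<times> {0..<2 * pi}"

definition solid_angle :: "(real \<times> real) measure" where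
  "solid_angle = density (lebesgue_on angles) (\<lambda>\<omega>. ennreal (sin (fst \<omega>)))"

definition ell_hat :: "real \<times> real \<Rightarrow> real ^ 3" where
  "ell_hat = (\<lambda>(\<theta>, \<phi>). vector [cos \<theta>, sin \<theta> * cos \<phi>, sin \<theta> * sin \<phi>])"

definition ell :: "real ^ 3 \<Rightarrow> real \<times> real \<Rightarrow> real \<times> (real ^ 3)" where
  "ell v \<omega> =
     (lorentz v * (v \<bullet> ell_hat \<omega>),
      if v = 0 then ell_hat \<omega>
      else ell_hat \<omega> + ((lorentz v - 1) * (v \<bullet> ell_hat \<omega>) / (norm v)\<^sup>2) *\<^sub>R v)"

definition ell_low :: "real ^ 3 \<Rightarrow> real \<times> real \<Rightarrow> real ^ 3" where
  "ell_low v \<omega> = snd (lower (ell v \<omega>))"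

definition moment_J :: "real \<Rightarrow> (real \<times> real \<Rightarrow> real) \<Rightarrow> real" where
  "moment_J \<epsilon> f = \<epsilon> / (4 * pi) * (\<integral>\<omega>. f \<omega> \<partial>solid_angle)"

definition moment_H :: "real ^ 3 \<Rightarrow> real \<Rightarrow> (real \<times> real \<Rightarrow> real) \<Rightarrow> real ^ 3" where
  "moment_H v \<epsilon> f = (\<chi> i. \<epsilon> / (4 * pi) * (\<integral>\<omega>. f \<omega> * ell_low v \<omega> $ i \<partial>solid_angle))"

definition moment_K :: "real ^ 3 \<Rightarrow> real \<Rightarrow> (real \<times> real \<Rightarrow> real) \<Rightarrow> real ^ 3 ^ 3" where
  "moment_K v \<epsilon> f =
     (\<chi> i j. \<epsilon> / (4 * pi) *
        (\<integral>\<omega>. f \<omega> * ell_low v \<omega> $ i * ell_low v \<omega> $ j \<partial>solid_angle))"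

definition exact_closure ::
    "real ^ 3 \<Rightarrow> real \<Rightarrow> real \<Rightarrow> real ^ 3 \<Rightarrow> real ^ 3 ^ 3 \<Rightarrow> bool" where
  "exact_closure v \<epsilon> J H K \<longleftrightarrow>
     (\<exists>f. (\<forall>\<omega>\<in>angles. f \<omega> \<ge> 0) \<and> integrable solid_angle f \<and>
          (\<integral>\<omega>. f \<omega> \<partial>solid_angle) > 0 \<and>
          J = moment_J \<epsilon> f \<and> H = moment_H v \<epsilon> f \<and> K = moment_K v \<epsilon> f)"

text \<open>
  Only the spatial components of the moments are recorded. No information is lost: the
  covector \<open>\<ell>\<^sub>\<mu>\<close> is orthogonal to the four-velocity, so integrating
  \<open>f \<ell>\<^sub>0\<close> gives \<open>- v \<bullet> moment_H v \<epsilon> f\<close>, and similarly for the tensor.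
\<close>

lemma norm_ell_hat: "norm (ell_hat \<omega>) = 1"
proof -
  obtain \<theta> \<phi> where w: "\<omega> = (\<theta>, \<phi>)" by (cases \<omega>)
  have "(sin \<theta> * cos \<phi>)\<^sup>2 + (sin \<theta> * sin \<phi>)\<^sup>2 = (sin \<theta>)\<^sup>2 * ((cos \<phi>)\<^sup>2 + (sin \<phi>)\<^sup>2)"
    by (simp only: power_mult_distrib distrib_left)
  hence "(cos \<theta>)\<^sup>2 + (sin \<theta> * cos \<phi>)\<^sup>2 + (sin \<theta> * sin \<phi>)\<^sup>2 = 1"
    using sin_cos_squared_add2[of \<theta>] by (simp only: add.assoc sin_cos_squared_add2 sin_cos_squared_add mult_1_right)
  thus ?thesis
    by (simp add: w ell_hat_def norm_eq_1 inner_vec_def sum_3 power2_eq_square)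
qed

lemma inner_ell: "v \<bullet> snd (ell v \<omega>) = lorentz v * (v \<bullet> ell_hat \<omega>)"
proof (cases "v = 0")
  case False
  hence "(norm v)\<^sup>2 \<noteq> 0" by simp
  thus ?thesis
    using False
    by (simp add: ell_def inner_add_right dot_square_norm) (simp add: algebra_simps)
qed simp

lemma mink_four_velocity_ell: "mink (four_velocity v) (ell v \<omega>) = 0"
  using inner_ell[of v \<omega>] by (simp add: mink_def four_velocity_def) (simp add: ell_def)

lemma lower_ell: "lower (ell v \<omega>) = orth_covector v (ell_low v \<omega>)"
  using inner_ell[of v \<omega>]
  by (simp add: lower_def ell_low_def orth_covector_def) (simp add: ell_def)

lemma mink_ell_ell:
  assumes "norm v < 1"
  shows "mink (ell v \<omega>) (ell v \<omega>) = 1"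
proof (cases "v = 0")
  case True
  thus ?thesis using norm_ell_hat[of \<omega>] by (simp add: mink_def ell_def norm_eq_1)
next
  case False
  define n2 where "n2 = (norm v)\<^sup>2"
  define W where "W = lorentz v"
  define s where "s = v \<bullet> ell_hat \<omega>"
  have n: "n2 \<noteq> 0" "n2 < 1"
    using False assms by (auto simp: n2_def power_less_one_iff abs_square_less_1)
  have W2: "W\<^sup>2 * (1 - n2) = 1"
    using n by (simp add: W_def lorentz_def n2_def[symmetric] power_divide)
  have hat: "ell_hat \<omega> \<bullet> ell_hat \<omega> = 1"
    using norm_ell_hat[of \<omega>] by (simp add: norm_eq_1)
  have s1: "v \<bullet> ell_hat \<omega> = s" and s2: "ell_hat \<omega> \<bullet> v = s"
    by (simp_all add: s_def inner_commute)
  have v2: "v \<bullet> v = n2" by (simp add: n2_def dot_square_norm)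
  define c where "c = (W - 1) * s / n2"
  have e: "ell v \<omega> = (W * s, ell_hat \<omega> + c *\<^sub>R v)"
    using False by (simp add: ell_def W_def s_def n2_def c_def)
  have "snd (ell v \<omega>) \<bullet> snd (ell v \<omega>) = 1 + 2 * c * s + c * (c * n2)"
    by (simp add: e inner_add_left inner_add_right hat s1 s2 v2 distrib_left)
  hence "mink (ell v \<omega>) (ell v \<omega>) = 1 + 2 * c * s + c * (c * n2) - W\<^sup>2 * s\<^sup>2"
    by (simp add: mink_def e power2_eq_square)
  also have "c * n2 = (W - 1) * s" using n by (simp add: c_def)
  also have "1 + 2 * c * s + c * ((W - 1) * s) - W\<^sup>2 * s\<^sup>2
      = 1 + (W\<^sup>2 - 1) * s\<^sup>2 / n2 - W\<^sup>2 * s\<^sup>2"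
    using n by (simp add: c_def field_simps power2_eq_square)
  also have "W\<^sup>2 - 1 = W\<^sup>2 * n2" using W2 by (simp add: algebra_simps)
  finally show ?thesis using n by simp
qed

end

theory Submission
  imports Defs
begin

text \<open>
  The substitution \<open>v\<^sup>i \<ell>\<^sub>i = W v\<^sub>j \<ell>\<^sup>j\<close> (hatted direction on the right) absorbs the factor
  \<open>1/W\<close> of the iteration, so the new pair is
  \<open>(\<lambda>/W) (E, F)\<close> plus the zeroth and first moments of the density
  \<open>f (1 - \<lambda> - \<lambda> v\<^sub>j \<ell>\<^sup>j)\<close>, which is nonnegative because \<open>\<lambda> (1 + v) \<le> 1\<close>. Since
  \<open>\<ell>\<^sub>\<mu>\<close> is a unit covector and the spacelike covectors orthogonal to \<open>u\<^sup>\<mu>\<close> form a normed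
  space, the first moment is bounded by the zeroth one, and adding the realizable pair
  \<open>(\<lambda>/W) (E, F)\<close> makes the energy strictly positive.
\<close>

text \<open>
  The coefficient solves \<open>t\<^sup>2 v\<^sup>2 + 2 t + 1 = 0\<close>; with it the Minkowski norm of an orthogonal
  covector becomes the Euclidean norm of the image of its spatial part.
\<close>

definition rest_frame :: "real ^ 3 \<Rightarrow> real ^ 3 \<Rightarrow> real ^ 3" where
  "rest_frame v b = b - ((v \<bullet> b) / (1 + sqrt (1 - (norm v)\<^sup>2))) *\<^sub>R v"

lemma bounded_linear_rest_frame: "bounded_linear (rest_frame v)"
proof -
  have "linear (rest_frame v)"
    by (rule linearI) (simp_all add: rest_frame_def inner_add_right add_divide_distrib algebra_simps)
  thus ?thesis by (rule linear_conv_bounded_linear[THEN iffD1])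
qed

lemma mink_orth_covector:
  assumes "norm v < 1"
  shows "mink (orth_covector v b) (orth_covector v b) = (norm (rest_frame v b))\<^sup>2"
proof -
  define s where "s = sqrt (1 - (norm v)\<^sup>2)"
  have "(norm v)\<^sup>2 \<le> 1" using assms by (simp add: power_le_one_iff)
  hence s: "s \<ge> 0" "v \<bullet> v = 1 - s\<^sup>2"
    by (simp_all add: s_def power2_norm_eq_inner[symmetric])
  define t where "t = 1 / (1 + s)"
  \<comment> \<open>Since \<open>1 - s\<^sup>2 = (1 - s) * (1 + s)\<close>, the left side is (1 -
    s)/(1 + s) - 2/(1 + s). Here \<open>t\<close> has the opposite sign to the root of the
    quadratic, as it enters \<open>rest_frame\<close> with a minus.\<close>
  have t: "t\<^sup>2 * (1 - s\<^sup>2) - 2 * t = - 1"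
    using s(1) by (simp add: t_def power_divide add_nonneg_eq_0_iff divide_simps)
      (simp add: power2_eq_square algebra_simps)
  have "rest_frame v b = b - (t * (v \<bullet> b)) *\<^sub>R v"
    by (simp add: rest_frame_def s_def t_def)
  hence "(norm (rest_frame v b))\<^sup>2
      = b \<bullet> b + (v \<bullet> b)\<^sup>2 * (t\<^sup>2 * (1 - s\<^sup>2) - 2 * t)"
    by (simp add: power2_norm_eq_inner inner_diff_left inner_diff_right s(2)
        inner_commute[of b v]) (simp add: power2_eq_square algebra_simps)
  thus ?thesis
    unfolding t by (simp add: mink_def orth_covector_def power2_eq_square)
qed

text \<open>Turns realizability into a cone condition for a Euclidean norm, so that sums and
  integrals are controlled by the triangle inequality.\<close>

lemma realizable_iff:
  assumes "norm v < 1"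
  shows "realizable v a b \<longleftrightarrow> a > 0 \<and> norm (rest_frame v b) \<le> a"
  by (simp add: realizable_def mink_orth_covector[OF assms])

text \<open>By \<open>lower_ell\<close> the covector is the lowered \<open>ell\<close>, and lowering
  only flips the sign of the time component, which \<open>mink\<close> does not see.\<close>

lemma norm_rest_frame_ell_low:
  assumes "norm v < 1"
  shows "norm (rest_frame v (ell_low v \<omega>)) = 1"
proof -
  have "mink (orth_covector v (ell_low v \<omega>)) (orth_covector v (ell_low v \<omega>)) = 1"
    using mink_ell_ell[OF assms, of \<omega>]
    by (simp flip: lower_ell) (simp add: mink_def lower_def)
  thus ?thesis
    by (simp add: mink_orth_covector[OF assms] power2_eq_1_iff) (smt (verit) norm_ge_zero)
qed

text \<open>The case split of \<open>ell\<close> disappears because the correction is a multiple of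
  \<open>v\<close>, hence zero for \<open>v = 0\<close>. For fixed \<open>v\<close> the formula is
  linear in \<open>ell_hat\<close>, which gives measurability and bounds.\<close>

lemma ell_low_eq:
  "ell_low v \<omega> = ell_hat \<omega> + ((lorentz v - 1) / (norm v)\<^sup>2 * (v \<bullet> ell_hat \<omega>)) *\<^sub>R v"
  by (simp add: ell_low_def lower_def ell_def)

text \<open>A crude bound whose point is uniformity in the angles: it makes products of an
  integrable function with \<open>ell_low\<close> integrable.\<close>

lemma norm_ell_low_le: "norm (ell_low v \<omega>) \<le> 1 + \<bar>(lorentz v - 1) / (norm v)\<^sup>2\<bar> * (norm v * norm v)"
proof -
  have "\<bar>v \<bullet> ell_hat \<omega>\<bar> \<le> norm v"
    using Cauchy_Schwarz_ineq2[of v "ell_hat \<omega>"] by (simp add: norm_ell_hat)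
  hence "\<bar>(lorentz v - 1) / (norm v)\<^sup>2\<bar> * (\<bar>v \<bullet> ell_hat \<omega>\<bar> * norm v)
      \<le> \<bar>(lorentz v - 1) / (norm v)\<^sup>2\<bar> * (norm v * norm v)"
    by (intro mult_left_mono mult_right_mono) auto
  moreover have "norm (ell_low v \<omega>)
      \<le> norm (ell_hat \<omega>) + norm (((lorentz v - 1) / (norm v)\<^sup>2 * (v \<bullet> ell_hat \<omega>)) *\<^sub>R v)"
    unfolding ell_low_eq by (rule norm_triangle_ineq)
  ultimately show ?thesis
    by (simp add: norm_ell_hat abs_mult mult.assoc)
qed

lemma inner_ell_low: "v \<bullet> ell_low v \<omega> = lorentz v * (v \<bullet> ell_hat \<omega>)"
  using inner_ell[of v \<omega>] by (simp add: ell_low_def lower_def)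

lemma continuous_on_ell_hat: "continuous_on UNIV ell_hat"
proof -
  have "continuous_on UNIV (\<lambda>\<omega>. ell_hat \<omega> $ i)" for i
  proof -
    have "\<forall>i. continuous_on UNIV (\<lambda>\<omega>. ell_hat \<omega> $ i)"
      unfolding forall_3 by (auto simp: ell_hat_def split_beta intro!: continuous_intros)
    thus ?thesis ..
  qed
  hence "continuous_on UNIV (\<lambda>\<omega>. \<chi> i. ell_hat \<omega> $ i)"
    by (rule continuous_on_vec_lambda)
  thus ?thesis by simp
qed

lemma borel_measurable_solid_angle:
  fixes g :: "real \<times> real \<Rightarrow> 'a :: euclidean_space"
  assumes "continuous_on UNIV g"
  shows "g \<in> borel_measurable solid_angle"
proof -
  have "g \<in> borel_measurable (lebesgue_on angles)"
    using borel_measurable_continuous_onI[OF assms]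
    by (intro measurable_restrict_space1 measurable_completion) simp
  thus ?thesis by (simp add: solid_angle_def)
qed

text \<open>The density \<open>f\<close> is nonnegative only on \<open>angles\<close>; as these are
  the whole space of the measure, pointwise facts there suffice under the integral.\<close>

lemma space_solid_angle: "space solid_angle = angles"
  by (simp add: solid_angle_def space_restrict_space)

lemma integrable_scaleR_bounded:
  fixes f :: "'a \<Rightarrow> real" and g :: "'a \<Rightarrow> 'b :: {banach, second_countable_topology}"
  assumes "integrable M f" "g \<in> borel_measurable M" "\<And>x. norm (g x) \<le> B"
  shows "integrable M (\<lambda>x. f x *\<^sub>R g x)"
proof (rule Bochner_Integration.integrable_bound)
  show "integrable M (\<lambda>x. B * f x)" using assms(1) by simp
  show "(\<lambda>x. f x *\<^sub>R g x) \<in> borel_measurable M"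
    using assms(1,2) by measurable
  have "\<bar>f x\<bar> * norm (g x) \<le> \<bar>B\<bar> * \<bar>f x\<bar>" for x
  proof -
    have "norm (g x) \<le> \<bar>B\<bar>" using assms(3)[of x] by linarith
    hence "\<bar>f x\<bar> * norm (g x) \<le> \<bar>f x\<bar> * \<bar>B\<bar>" by (intro mult_left_mono) auto
    thus ?thesis by (simp add: mult.commute)
  qed
  thus "AE x in M. norm (f x *\<^sub>R g x) \<le> norm (B * f x)"
    by (simp add: abs_mult)
qed

lemma integral_vec_nth:
  fixes g :: "'a \<Rightarrow> real ^ 'n"
  assumes "integrable M g"
  shows "(\<integral>x. g x $ i \<partial>M) = (\<integral>x. g x \<partial>M) $ i"
  using integral_bounded_linear[OF bounded_linear_vec_nth assms] by simp

theorem lemma6: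
  fixes v :: "real ^ 3"
    and \<epsilon> lam Ehat :: real and Fhat :: "real ^ 3"
    and J :: "nat \<Rightarrow> real" and H :: "nat \<Rightarrow> real ^ 3" and K :: "nat \<Rightarrow> real ^ 3 ^ 3"
    and k :: nat
  assumes "norm v < 1"
    and "\<epsilon> > 0"
    and "realizable v Ehat Fhat"
    and "realizable v (J k) (H k)"
    and "exact_closure v \<epsilon> (J k) (H k) (K k)"
    and "0 < lam" and "lam \<le> 1 / (1 + norm v)"
    and "J (Suc k) = J k - lam / lorentz v * (lorentz v * J k + v \<bullet> H k - Ehat)"
    and "\<And>j. H (Suc k) $ j = H k $ j
           - lam / lorentz v * (lorentz v * H k $ j + (\<Sum>i\<in>UNIV. v $ i * K k $ i $ j) - Fhat $ j)"
  shows "realizable v (J (Suc k)) (H (Suc k))"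
proof -
  let ?S = "solid_angle"
  define W where "W = lorentz v"
  define s where "s = (\<lambda>\<omega>. v \<bullet> ell_hat \<omega>)"
  define c where "c = \<epsilon> / (4 * pi)"
  have "(norm v)\<^sup>2 < 1" using assms(1) by (simp add: power_less_one_iff)
  hence W: "W > 0" by (simp add: W_def lorentz_def)
  have c: "c > 0" using assms(2) by (simp add: c_def)
  obtain f where f: "\<And>\<omega>. \<omega> \<in> angles \<Longrightarrow> f \<omega> \<ge> 0" "integrable ?S f"
    and J: "J k = moment_J \<epsilon> f" and H: "H k = moment_H v \<epsilon> f" and K: "K k = moment_K v \<epsilon> f"
    using assms(5) unfolding exact_closure_def by blast

  have ell_meas: "ell_low v \<in> borel_measurable ?S"
    unfolding ell_low_eq
    by (intro borel_measurable_solid_angle continuous_intros continuous_on_ell_hat)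
  have s_meas: "s \<in> borel_measurable ?S"
    unfolding s_def by (intro borel_measurable_solid_angle continuous_intros continuous_on_ell_hat)
  have s_le: "\<bar>s \<omega>\<bar> \<le> norm v" for \<omega>
    using Cauchy_Schwarz_ineq2[of v "ell_hat \<omega>"] by (simp add: s_def norm_ell_hat)
  have fs_int: "integrable ?S (\<lambda>\<omega>. f \<omega> * s \<omega>)"
    using integrable_scaleR_bounded[OF f(2) s_meas, of "norm v"] s_le by simp
  have fl_int: "integrable ?S (\<lambda>\<omega>. f \<omega> *\<^sub>R ell_low v \<omega>)"
    by (rule integrable_scaleR_bounded[OF f(2) ell_meas norm_ell_low_le])
  have fsl_int: "integrable ?S (\<lambda>\<omega>. (f \<omega> * s \<omega>) *\<^sub>R ell_low v \<omega>)"
    by (rule integrable_scaleR_bounded[OF fs_int ell_meas norm_ell_low_le])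

  \<comment> \<open>This is \<open>f\<close> times \<open>1 - lam - lam * s\<close>, left expanded
    so that its moments split into those of \<open>f\<close> and of \<open>f * s\<close>.\<close>
  define g where "g = (\<lambda>\<omega>. (1 - lam) * f \<omega> - lam * (f \<omega> * s \<omega>))"
  have g_nonneg: "g \<omega> \<ge> 0" if "\<omega> \<in> angles" for \<omega>
  proof -
    \<comment> \<open>The worst direction is \<open>ell_hat\<close> parallel to \<open>v\<close>,
      where \<open>s\<close> reaches \<open>norm v\<close>; this is what fixes the bound on
      \<open>lam\<close>.\<close>
    have "lam * (1 + norm v) \<le> 1"
      using assms(7) by (simp add: pos_le_divide_eq add_pos_nonneg)
    moreover have "lam * s \<omega> \<le> lam * norm v"
      using assms(6) s_le[of \<omega>] by (intro mult_left_mono) auto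
    ultimately have "0 \<le> f \<omega> * (1 - lam - lam * s \<omega>)"
      using f(1)[OF that] by (intro mult_nonneg_nonneg) (auto simp: algebra_simps)
    thus ?thesis by (simp add: g_def algebra_simps)
  qed
  define A where "A = (\<integral>\<omega>. g \<omega> \<partial>?S)"
  define B where "B = (\<integral>\<omega>. g \<omega> *\<^sub>R ell_low v \<omega> \<partial>?S)"
  have A: "A = (1 - lam) * (\<integral>\<omega>. f \<omega> \<partial>?S) - lam * (\<integral>\<omega>. f \<omega> * s \<omega> \<partial>?S)"
    using f(2) fs_int by (simp add: A_def g_def)
  \<comment> \<open>The grouping isolates the two integrands already known to be integrable.\<close>
  have g_ell: "(\<lambda>\<omega>. g \<omega> *\<^sub>R ell_low v \<omega>)
      = (\<lambda>\<omega>. (1 - lam) *\<^sub>R (f \<omega> *\<^sub>R ell_low v \<omega>) - lam *\<^sub>R ((f \<omega> * s \<omega>) *\<^sub>R ell_low v \<omega>))"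
    by (simp add: g_def scaleR_diff_left)
  have B: "B = (1 - lam) *\<^sub>R (\<integral>\<omega>. f \<omega> *\<^sub>R ell_low v \<omega> \<partial>?S)
      - lam *\<^sub>R (\<integral>\<omega>. (f \<omega> * s \<omega>) *\<^sub>R ell_low v \<omega> \<partial>?S)"
    unfolding B_def g_ell using fl_int fsl_int by (simp del: scaleR_scaleR)
  have gl_int: "integrable ?S (\<lambda>\<omega>. g \<omega> *\<^sub>R ell_low v \<omega>)"
    unfolding g_ell using fl_int fsl_int by (simp del: scaleR_scaleR)

  \<comment> \<open>The componentwise moment becomes one vector-valued integral, through which
    linear maps can be moved.\<close>
  have H_vec: "H k = c *\<^sub>R (\<integral>\<omega>. f \<omega> *\<^sub>R ell_low v \<omega> \<partial>?S)"
    using integral_vec_nth[OF fl_int] by (simp add: H moment_H_def c_def vec_eq_iff)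
  have "v \<bullet> H k = c * (\<integral>\<omega>. v \<bullet> (f \<omega> *\<^sub>R ell_low v \<omega>) \<partial>?S)"
    using integral_inner_right[of v ?S "\<lambda>\<omega>. f \<omega> *\<^sub>R ell_low v \<omega>"] fl_int by (simp add: H_vec)
  also have "(\<lambda>\<omega>. v \<bullet> (f \<omega> *\<^sub>R ell_low v \<omega>)) = (\<lambda>\<omega>. W * (f \<omega> * s \<omega>))"
    by (simp add: inner_ell_low W_def s_def mult_ac)
  finally have vH: "v \<bullet> H k = W * (c * (\<integral>\<omega>. f \<omega> * s \<omega> \<partial>?S))" by simp
  \<comment> \<open>Contracting the first index with \<open>v\<close> replaces one factor
    \<open>ell_low\<close> by \<open>W * s\<close>, so the second moment of \<open>f\<close> reduces
    to a first moment of \<open>f * s\<close>.\<close>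
  have vK: "(\<Sum>i\<in>UNIV. v $ i * K k $ i $ j)
      = W * (c * (\<integral>\<omega>. (f \<omega> * s \<omega>) *\<^sub>R ell_low v \<omega> \<partial>?S) $ j)" for j
  proof -
    have int: "integrable ?S (\<lambda>\<omega>. f \<omega> * ell_low v \<omega> $ i * ell_low v \<omega> $ j)" for i
    proof -
      have "integrable ?S (\<lambda>\<omega>. f \<omega> * ell_low v \<omega> $ i)"
        using integrable_bounded_linear[OF bounded_linear_vec_nth fl_int] by simp
      hence "integrable ?S (\<lambda>\<omega>. (f \<omega> * ell_low v \<omega> $ i) *\<^sub>R ell_low v \<omega>)"
        by (rule integrable_scaleR_bounded[OF _ ell_meas norm_ell_low_le])
      from integrable_bounded_linear[OF bounded_linear_vec_nth this] show ?thesis by simp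
    qed
    have "(\<Sum>i\<in>UNIV. v $ i * K k $ i $ j)
        = c * (\<Sum>i\<in>UNIV. v $ i * (\<integral>\<omega>. f \<omega> * ell_low v \<omega> $ i * ell_low v \<omega> $ j \<partial>?S))"
      unfolding K moment_K_def c_def by (simp add: sum_distrib_left mult_ac)
    also have "\<dots> = c * (\<integral>\<omega>. (\<Sum>i\<in>UNIV. v $ i * (f \<omega> * ell_low v \<omega> $ i * ell_low v \<omega> $ j)) \<partial>?S)"
      using int by (subst Bochner_Integration.integral_sum) auto
    also have "(\<lambda>\<omega>. \<Sum>i\<in>UNIV. v $ i * (f \<omega> * ell_low v \<omega> $ i * ell_low v \<omega> $ j))
        = (\<lambda>\<omega>. f \<omega> * ell_low v \<omega> $ j * (v \<bullet> ell_low v \<omega>))"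
      by (simp add: inner_vec_def sum_distrib_left mult_ac)
    also have "\<dots> = (\<lambda>\<omega>. W * ((f \<omega> * s \<omega>) *\<^sub>R ell_low v \<omega>) $ j)"
      by (simp add: inner_ell_low W_def s_def mult_ac)
    finally show ?thesis
      using integral_vec_nth[OF fsl_int, of j] by simp
  qed

  have J': "J (Suc k) = c * A + lam / W * Ehat"
    unfolding assms(8) vH A W_def[symmetric] using W
    by (simp add: J moment_J_def flip: c_def) (simp add: field_simps)
  have H': "H (Suc k) = c *\<^sub>R B + (lam / W) *\<^sub>R Fhat"
    unfolding vec_eq_iff assms(9) vK W_def[symmetric] B H_vec using W
    by (simp add: field_simps)

  \<comment> \<open>\<open>A\<close> can vanish: for \<open>v = 0\<close> and \<open>lam = 1\<close>
    the function \<open>g\<close> is zero. Strict positivity of the new energy therefore comes from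
    \<open>Ehat\<close>.\<close>
  have A_nonneg: "A \<ge> 0"
    unfolding A_def by (rule Bochner_Integration.integral_nonneg) (simp add: g_nonneg space_solid_angle)
  \<comment> \<open>After \<open>rest_frame\<close> is moved inside by linearity, the integrand has
    norm exactly \<open>g\<close>, because \<open>ell_low\<close> is a unit vector there and
    \<open>g\<close> is nonnegative on \<open>angles\<close>.\<close>
  have B_le: "norm (rest_frame v B) \<le> A"
  proof -
    have "rest_frame v B = (\<integral>\<omega>. rest_frame v (g \<omega> *\<^sub>R ell_low v \<omega>) \<partial>?S)"
      unfolding B_def by (rule integral_bounded_linear[OF bounded_linear_rest_frame gl_int, symmetric])
    also have "norm \<dots> \<le> (\<integral>\<omega>. norm (rest_frame v (g \<omega> *\<^sub>R ell_low v \<omega>)) \<partial>?S)"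
      by (rule integral_norm_bound)
    also have "\<dots> = A"
      unfolding A_def
      by (rule Bochner_Integration.integral_cong)
        (auto simp: linear_scale[OF bounded_linear.linear[OF bounded_linear_rest_frame]]
          norm_rest_frame_ell_low[OF assms(1)] g_nonneg space_solid_angle)
    finally show ?thesis .
  qed
  have E: "Ehat > 0" "norm (rest_frame v Fhat) \<le> Ehat"
    using assms(3) by (simp_all add: realizable_iff[OF assms(1)])
  have "rest_frame v (H (Suc k)) = c *\<^sub>R rest_frame v B + (lam / W) *\<^sub>R rest_frame v Fhat"
    using bounded_linear.linear[OF bounded_linear_rest_frame, of v]
    by (simp add: H' linear_add linear_scale)
  \<comment> \<open>Both coefficients are nonnegative, so the cone inequalities for
    (\<open>A\<close>, \<open>B\<close>) and (\<open>Ehat\<close>, \<open>Fhat\<close>) add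
    up.\<close>
  hence "norm (rest_frame v (H (Suc k)))
      \<le> c * norm (rest_frame v B) + lam / W * norm (rest_frame v Fhat)"
    using norm_triangle_ineq[of "c *\<^sub>R rest_frame v B" "(lam / W) *\<^sub>R rest_frame v Fhat"]
      c W assms(6) by simp
  also have "\<dots> \<le> J (Suc k)"
    unfolding J' using c W assms(6) B_le E(2) by (intro add_mono mult_left_mono) auto
  finally have "norm (rest_frame v (H (Suc k))) \<le> J (Suc k)" .
  moreover have "J (Suc k) > 0"
    unfolding J' using c W assms(6) A_nonneg E(1) by (intro add_nonneg_pos) auto
  ultimately show ?thesis by (simp add: realizable_iff[OF assms(1)])
qed

end
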